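(* Let $x$ be a complex number and $n$ a nonnegative integer such that all quantities below are defined. Then \[ \sum_{k=0}^n(-1)^k\binom{n}{k}\frac{\binom{2x+n+k}{k}}{\binom{x+k}{k}}kH_{k}=\frac{n(2x+n+1)}{x+1} \times\begin{cases} H_{m-1}(x+1)+2H_{2m}-H_m, & n=2m;\\[1mm] H_m-2H_{2m}-H_m(x+1)-\frac{x+1}{(2m+1)(x+m+1)}, & n=2m+1. \end{cases} \]
   Context: For a complex $y$ and an integer $k\ge 0$, $\binom{y}{k}=\frac{y(y-1)\cdots(y-k+1)}{k!}$. For complex $x$ and integer $n\ge0$, $H_0(x)=0$, $H_n(x)=\sum_{k=1}^n\frac{1}{x+k}$, and $H_n=H_n(0)$. For a negative index one uses the convention $H_{-j}(y)=-\sum_{i=0}^{j-1}\frac{1}{y-i}$ (e.g. $H_{-1}(y)=-1/y$); this only arises for $n=0$, where it is multiplied by $n=0$. *)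

theory Defs
  imports Complex_Main
begin

text \<open>
  \<open>gen_harm n x\<close> is $H_n(x)$ with an integer index: the second branch is the convention
  $H_{-j}(y) = -\sum_{i=0}^{j-1} 1/(y-i)$ for $j > 0$.
\<close>

definition gen_harm :: "int \<Rightarrow> complex \<Rightarrow> complex" where
  "gen_harm n x =
     (if n \<ge> 0 then \<Sum>k = 1..nat n. 1 / (x + of_nat k)
      else - (\<Sum>i<nat (- n). 1 / (x - of_nat i)))"

abbreviation harm_num :: "nat \<Rightarrow> complex" where
  "harm_num n \<equiv> gen_harm (int n) 0"

end

theory Submission
  imports Defs "HOL-Computational_Algebra.Formal_Power_Series"
begin

text \<open>
  Let $w_{n,x}(k)$ be the coefficient of $t^k$ in ${}_2F_1(-n, 2x+n+1; x+1; t)$, that is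
  $(-1)^k \binom{n}{k} \binom{2x+n+k}{k} / \binom{x+k}{k}$. As $k\,w_{n,x}(k)$ is a multiple of
  $w_{n-1,x+1}(k-1)$ and $H_k = H_{k-1} + 1/k$, the factor $k$ can be removed from the sum. The
  polynomial $P(t) = \sum_k w_{n,x}(k) t^k$ satisfies $P(1-t) = (-1)^n P(t)$, so inserting
  $H_k = \sum_{i\ge1} (-1)^{i-1} \binom{k}{i} / i$ removes the harmonic numbers too and leaves
  $Q_n(x) = \sum_{i\ge1} w_{n,x}(i)/i$. The difference $Q_n - Q_{n-1}$ is a Chu--Vandermonde sum
  without its first term, which telescopes for even $n$ and collapses by symmetry for odd $n$.
\<close>

section \<open>Terminating hypergeometric sums\<close>

definition hypergeo_coeff :: "'a::field_char_0 \<Rightarrow> 'a \<Rightarrow> 'a \<Rightarrow> nat \<Rightarrow> 'a" where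
  "hypergeo_coeff a b c k = pochhammer a k * pochhammer b k / (fact k * pochhammer c k)"

lemma hypergeo_coeff_0 [simp]: "hypergeo_coeff a b c 0 = 1"
  by (simp add: hypergeo_coeff_def)

lemma hypergeo_coeff_eq_0: "n < k \<Longrightarrow> hypergeo_coeff (- of_nat n) b c k = 0"
  by (simp add: hypergeo_coeff_def pochhammer_of_nat_eq_0_lemma)

lemma hypergeo_coeff_add:
  fixes a b c :: "'a::field_char_0"
  shows "hypergeo_coeff a b c (i + l) * of_nat ((i + l) choose i)
    = hypergeo_coeff a b c i * hypergeo_coeff (a + of_nat i) (b + of_nat i) (c + of_nat i) l"
proof -
  have choose: "of_nat ((i + l) choose i) = (fact (i + l) / (fact i * fact l) :: 'a)"
    by (simp add: binomial_fact)
  show ?thesis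
    unfolding choose hypergeo_coeff_def pochhammer_product' by (simp add: field_simps)
qed

lemma of_nat_Suc_mult_hypergeo_coeff:
  "of_nat (Suc k) * hypergeo_coeff a b c (Suc k)
    = a * b / c * hypergeo_coeff (a + 1) (b + 1) (c + 1) k"
  using hypergeo_coeff_add[of a b c 1 k]
  by (simp add: hypergeo_coeff_def[of _ _ _ "Suc 0"] mult.commute)

lemma sum_hypergeo_coeff:
  assumes "pochhammer c n \<noteq> 0"
  shows "(\<Sum>k\<le>n. hypergeo_coeff (- of_nat n) b c k) = pochhammer (c - b) n / pochhammer c n"
proof -
  have "\<forall>i\<in>{0..<n}. c \<noteq> - of_nat i"
    using assms by (auto simp: pochhammer_eq_0_iff)
  from Vandermonde_pochhammer[OF this, of b] show ?thesis
    by (simp add: hypergeo_coeff_def atMost_atLeast0 mult.commute)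
qed

lemma sum_hypergeo_coeff_binomial:
  assumes "pochhammer c n \<noteq> 0" "i \<le> n"
  shows "(\<Sum>k\<le>n. hypergeo_coeff (- of_nat n) b c k * of_nat (k choose i))
    = hypergeo_coeff (- of_nat n) b c i
      * (pochhammer (c - b) (n - i) / pochhammer (c + of_nat i) (n - i))"
proof -
  obtain d where d: "n = i + d"
    using assms(2) le_Suc_ex by blast
  have shifted: "pochhammer (c + of_nat i) d \<noteq> 0"
    using assms(1) by (simp add: d pochhammer_product')
  have "(\<Sum>k\<le>n. hypergeo_coeff (- of_nat n) b c k * of_nat (k choose i))
      = (\<Sum>k=i..n. hypergeo_coeff (- of_nat n) b c k * of_nat (k choose i))"
    by (rule sum.mono_neutral_right) auto
  also have "\<dots> = (\<Sum>l\<le>d. hypergeo_coeff (- of_nat n) b c (i + l) * of_nat ((i + l) choose i))"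
    unfolding d by (rule sum.reindex_bij_witness[of _ "\<lambda>l. i + l" "\<lambda>k. k - i"]) auto
  also have "\<dots> = hypergeo_coeff (- of_nat n) b c i
      * (\<Sum>l\<le>d. hypergeo_coeff (- of_nat d) (b + of_nat i) (c + of_nat i) l)"
    by (simp add: hypergeo_coeff_add sum_distrib_left d)
  finally show ?thesis
    by (simp add: sum_hypergeo_coeff[OF shifted] d)
qed

lemma gchoose_add_eq_pochhammer:
  fixes y :: "'a::field_char_0"
  shows "(y + of_nat k) gchoose k = pochhammer (y + 1) k / fact k"
  by (simp add: gbinomial_pochhammer')

lemma pochhammer_minus_of_nat_div_fact:
  "pochhammer (- of_nat n :: 'a::field_char_0) k / fact k = (-1) ^ k * of_nat (n choose k)"
  by (simp add: binomial_gbinomial gbinomial_pochhammer flip: power_add mult.assoc)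

lemma pochhammer_minus_of_nat_Suc_diff:
  "pochhammer (- of_nat (Suc n)) (Suc k) - pochhammer (- of_nat n) (Suc k)
    = - (of_nat (Suc k) * pochhammer (- of_nat n :: 'a::comm_ring_1) k)"
proof -
  have "pochhammer (- of_nat (Suc n)) (Suc k) = - of_nat (Suc n) * pochhammer (- of_nat n :: 'a) k"
    by (simp add: pochhammer_rec)
  moreover have "pochhammer (- of_nat n) (Suc k)
      = (of_nat k - of_nat n) * pochhammer (- of_nat n :: 'a) k"
    by (simp add: pochhammer_rec')
  ultimately show ?thesis
    by (simp only:) (simp add: algebra_simps)
qed

text \<open>For \<open>b \<noteq> 1\<close> the left-hand side is $1/(b-1)$ times a Chu--Vandermonde sum without its
  first term; the right-hand side has no denominator $b-1$ and so covers $b = 1$ as well.\<close>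

lemma sum_pochhammer_Vandermonde_tail:
  fixes b c :: "'a::field_char_0"
  assumes "pochhammer c n \<noteq> 0"
  shows "(\<Sum>i<n. pochhammer (- of_nat n) (Suc i) * pochhammer b i
      / (fact (Suc i) * pochhammer c (Suc i)))
    = - (\<Sum>j<n. pochhammer (c - b + 1) j / pochhammer c (Suc j))"
  using assms
proof (induction n)
  case 0
  show ?case by simp
next
  case (Suc n)
  define s where "s m i = pochhammer (- of_nat m) (Suc i) * pochhammer b i
    / (fact (Suc i) * pochhammer c (Suc i))" for m i
  have nonzero: "c \<noteq> 0" "pochhammer (c + 1) n \<noteq> 0" "pochhammer c n \<noteq> 0"
    using Suc.prems pochhammer_neq_0_mono[OF Suc.prems, of n] by (auto simp: pochhammer_rec)
  have "s (Suc n) i - s n i = - (hypergeo_coeff (- of_nat n) b (c + 1) i / c)" for i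
  proof -
    have "s (Suc n) i - s n i
        = - (of_nat (Suc i) * pochhammer (- of_nat n) i) * pochhammer b i
          / (fact (Suc i) * pochhammer c (Suc i))"
      by (simp only: s_def pochhammer_minus_of_nat_Suc_diff
          flip: diff_divide_distrib left_diff_distrib)
    also have "\<dots> = - (hypergeo_coeff (- of_nat n) b (c + 1) i / c)"
      by (simp add: hypergeo_coeff_def pochhammer_rec[of c] del: of_nat_Suc)
    finally show ?thesis .
  qed
  then have "(\<Sum>i\<le>n. s (Suc n) i) - (\<Sum>i\<le>n. s n i)
      = - (\<Sum>i\<le>n. hypergeo_coeff (- of_nat n) b (c + 1) i) / c"
    by (simp add: sum_negf sum_divide_distrib flip: sum_subtractf)
  also have "\<dots> = - (pochhammer (c - b + 1) n / pochhammer c (Suc n))"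
    unfolding sum_hypergeo_coeff[OF nonzero(2)]
    by (simp add: pochhammer_rec[of c] diff_add_eq mult.commute)
  also have "(\<Sum>i\<le>n. s n i) = (\<Sum>i<n. s n i)"
    by (rule sum.mono_neutral_right) (auto simp: s_def pochhammer_of_nat_eq_0_lemma)
  also have "(\<Sum>i<n. s n i) = - (\<Sum>j<n. pochhammer (c - b + 1) j / pochhammer c (Suc j))"
    unfolding s_def by (rule Suc.IH[OF nonzero(3)])
  finally show ?case
    by (simp add: s_def algebra_simps del: of_nat_Suc fact_Suc flip: lessThan_Suc_atMost)
qed

lemma sum_pochhammer_quotient_telescope:
  fixes c d :: "'a::field_char_0"
  assumes "pochhammer c n \<noteq> 0"
  shows "(c - d) * (\<Sum>j<n. pochhammer d j / pochhammer c (Suc j))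
      = 1 - pochhammer d n / pochhammer c n"
proof -
  have "(c - d) * (pochhammer d j / pochhammer c (Suc j))
      = pochhammer d j / pochhammer c j - pochhammer d (Suc j) / pochhammer c (Suc j)"
      if "j < n" for j
  proof -
    have "pochhammer c j \<noteq> 0" "c + of_nat j \<noteq> 0"
      using pochhammer_neq_0_mono[OF assms, of "Suc j"] that by (simp_all add: pochhammer_Suc)
    then show ?thesis
      by (simp add: pochhammer_Suc divide_simps) (simp add: algebra_simps)
  qed
  then show ?thesis
    by (simp add: sum_distrib_left
        sum_lessThan_telescope'[of "\<lambda>j. pochhammer d j / pochhammer c j"])
qed

lemma alternating_self_convolution_eq_0:
  fixes u :: "nat \<Rightarrow> 'a::{idom, ring_char_0}"
  assumes "odd n"
  shows "(\<Sum>j\<le>n. (-1) ^ j * (u j * u (n - j))) = 0"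
proof -
  have "(\<Sum>j\<le>n. (-1) ^ j * (u j * u (n - j))) = (\<Sum>j\<le>n. (-1) ^ (n - j) * (u (n - j) * u j))"
    by (rule sum.reindex_bij_witness[of _ "\<lambda>j. n - j" "\<lambda>j. n - j"]) auto
  also have "\<dots> = - (\<Sum>j\<le>n. (-1) ^ j * (u j * u (n - j)))"
    unfolding sum_negf[symmetric]
    by (rule sum.cong) (use assms in \<open>simp_all add: minus_one_power_iff mult.commute\<close>)
  finally show ?thesis
    by (simp add: eq_neg_iff_add_eq_0 flip: mult_2)
qed

lemma sum_pochhammer_quotient_reflect:
  fixes c :: "'a::field_char_0"
  assumes "odd n" "pochhammer c n \<noteq> 0"
  shows "(\<Sum>j<n. pochhammer (2 - c - of_nat n) j / pochhammer c (Suc j)) = 1 / (c + of_nat (n - 1))"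
proof -
  define u where "u j = 1 / pochhammer c j" for j
  obtain m where n: "n = Suc m"
    using assms(1) by (auto elim: oddE)
  have nonzero: "pochhammer c j \<noteq> 0" if "j \<le> n" for j
    using pochhammer_neq_0_mono[OF assms(2) that] .
  have "pochhammer (2 - c - of_nat n) j / pochhammer c (Suc j)
      = - pochhammer c m * ((-1) ^ Suc j * (u (Suc j) * u (n - Suc j)))" if "j < n" for j
  proof -
    have "pochhammer (2 - c - of_nat n) j = pochhammer (- (c + of_nat m - 1)) j"
      by (simp add: n algebra_simps)
    also have "\<dots> = (-1) ^ j * pochhammer (c + of_nat (m - j)) j"
      unfolding pochhammer_minus using that by (simp add: n of_nat_diff algebra_simps)
    also have "\<dots> = (-1) ^ j * pochhammer c m * u (m - j)"
      using that nonzero[of "m - j"] pochhammer_product[of "m - j" m c] by (simp add: u_def n)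
    finally show ?thesis
      by (simp add: u_def n mult_ac)
  qed
  then have "(\<Sum>j<n. pochhammer (2 - c - of_nat n) j / pochhammer c (Suc j))
      = - pochhammer c m * (\<Sum>j<n. (-1) ^ Suc j * (u (Suc j) * u (n - Suc j)))"
    unfolding sum_distrib_left by (intro sum.cong) auto
  also have "(\<Sum>j<n. (-1) ^ Suc j * (u (Suc j) * u (n - Suc j))) = - u n"
    using alternating_self_convolution_eq_0[OF assms(1), of u]
    by (simp add: sum.atMost_shift u_def[of 0] add_eq_0_iff del: power_Suc)
  also have "- pochhammer c m * - u n = 1 / (c + of_nat (n - 1))"
    using nonzero[of m] by (simp add: u_def n pochhammer_Suc)
  finally show ?thesis .
qed

section \<open>Gegenbauer coefficients\<close>

text \<open>The coefficients of $C_n^{(\lambda)}(1-2t) / C_n^{(\lambda)}(1)$ with $\lambda = x + 1/2$.\<close>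

definition gegenbauer_coeff :: "nat \<Rightarrow> 'a::field_char_0 \<Rightarrow> nat \<Rightarrow> 'a" where
  "gegenbauer_coeff n x = hypergeo_coeff (- of_nat n) (2 * x + of_nat n + 1) (x + 1)"

lemma gegenbauer_coeff_eq_gchoose:
  "gegenbauer_coeff n x k = (-1) ^ k * of_nat (n choose k)
      * (((2 * x + of_nat n + of_nat k) gchoose k) / ((x + of_nat k) gchoose k))"
  unfolding pochhammer_minus_of_nat_div_fact[symmetric] gchoose_add_eq_pochhammer
  by (simp add: gegenbauer_coeff_def hypergeo_coeff_def)

lemma gegenbauer_coeff_0 [simp]: "gegenbauer_coeff n x 0 = 1"
  by (simp add: gegenbauer_coeff_def)

lemma gegenbauer_coeff_eq_0: "n < k \<Longrightarrow> gegenbauer_coeff n x k = 0"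
  by (simp add: gegenbauer_coeff_def hypergeo_coeff_eq_0)

text \<open>The reflection $P(1-t) = (-1)^n P(t)$, read off from the Taylor coefficients at $t = 1$.\<close>

lemma sum_gegenbauer_coeff_binomial:
  assumes "pochhammer (x + 1) n \<noteq> 0"
  shows "(\<Sum>k\<le>n. gegenbauer_coeff n x k * of_nat (k choose i))
      = (-1) ^ (n + i) * gegenbauer_coeff n x i"
proof (cases "i \<le> n")
  case True
  then obtain d where d: "n = i + d"
    using le_Suc_ex by blast
  have "pochhammer (x + 1 + of_nat i) d \<noteq> 0"
    using assms by (simp add: d pochhammer_product')
  moreover have "pochhammer (x + 1 - (2 * x + of_nat n + 1)) d
      = (-1) ^ d * pochhammer (x + 1 + of_nat i) d"
    using pochhammer_minus[of "x + of_nat n" d] by (simp add: d add_ac)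
  ultimately show ?thesis
    unfolding gegenbauer_coeff_def sum_hypergeo_coeff_binomial[OF assms True]
    by (simp add: d power_add)
next
  case False
  then have "(\<Sum>k\<le>n. gegenbauer_coeff n x k * of_nat (k choose i)) = 0"
    by (intro sum.neutral) auto
  with False show ?thesis
    by (simp add: gegenbauer_coeff_eq_0)
qed

lemma of_nat_Suc_mult_gegenbauer_coeff:
  fixes x :: "'a::field_char_0"
  shows "of_nat (Suc k) * gegenbauer_coeff (Suc n) x (Suc k)
    = - (of_nat (Suc n) * (2 * x + of_nat (Suc n) + 1) / (x + 1)) * gegenbauer_coeff n (x + 1) k"
proof -
  have shift: "2 * x + of_nat (Suc n) + 1 + 1 = 2 * (x + 1) + of_nat n + 1"
    "- of_nat (Suc n) + 1 = (- of_nat n :: 'a)"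
    by simp_all
  show ?thesis
    unfolding gegenbauer_coeff_def of_nat_Suc_mult_hypergeo_coeff shift
    by (simp only: mult_minus_left minus_divide_left)
qed

text \<open>If $P(t)$ is the polynomial with these coefficients, this is $\int_0^1 (P(t) - 1)/t \, dt$.\<close>

definition gegenbauer_log_sum :: "nat \<Rightarrow> 'a::field_char_0 \<Rightarrow> 'a" where
  "gegenbauer_log_sum n x = (\<Sum>i<n. gegenbauer_coeff n x (Suc i) / of_nat (Suc i))"

lemma gegenbauer_coeff_Suc_diff:
  fixes x :: "'a::field_char_0"
  shows "of_nat (Suc n)
      * ((gegenbauer_coeff (Suc n) x (Suc i) - gegenbauer_coeff n x (Suc i)) / of_nat (Suc i))
    = 2 * (x + of_nat (Suc n)) * (pochhammer (- of_nat (Suc n)) (Suc i)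
        * pochhammer (2 * x + of_nat (Suc n) + 1) i / (fact (Suc i) * pochhammer (x + 1) (Suc i)))"
proof -
  define A where "A = pochhammer (- of_nat n :: 'a) i"
  define B where "B = pochhammer (2 * x + of_nat (Suc n) + 1) i"
  have lower: "pochhammer (- of_nat (Suc n)) (Suc i) = - of_nat (Suc n) * A"
    "pochhammer (- of_nat n) (Suc i) = A * (of_nat i - of_nat n)"
    by (simp add: pochhammer_rec A_def) (simp add: pochhammer_Suc A_def)
  have upper: "pochhammer (2 * x + of_nat (Suc n) + 1) (Suc i)
      = B * (2 * x + of_nat (Suc n) + 1 + of_nat i)"
    "pochhammer (2 * x + of_nat n + 1) (Suc i) = (2 * x + of_nat (Suc n)) * B"
    by (simp add: pochhammer_Suc B_def) (simp add: pochhammer_rec B_def algebra_simps)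
  have "gegenbauer_coeff (Suc n) x (Suc i) - gegenbauer_coeff n x (Suc i)
      = of_nat (Suc i) * (- 2 * (x + of_nat (Suc n)) * A * B
        / (fact (Suc i) * pochhammer (x + 1) (Suc i)))"
    unfolding gegenbauer_coeff_def hypergeo_coeff_def lower upper diff_divide_distrib[symmetric]
      times_divide_eq_right
    by (rule arg_cong2[where f = "(/)"]) (simp_all add: algebra_simps)
  then show ?thesis
    unfolding lower B_def[symmetric]
    by (simp add: mult_ac del: of_nat_Suc fact_Suc distrib_left_numeral distrib_right_numeral)
qed

lemma gegenbauer_log_sum_Suc:
  assumes "pochhammer (x + 1) (Suc n) \<noteq> 0"
  shows "of_nat (Suc n) * (gegenbauer_log_sum (Suc n) x - gegenbauer_log_sum n x)
    = - 2 * (x + of_nat (Suc n))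
      * (\<Sum>j<Suc n. pochhammer (- (x + of_nat n)) j / pochhammer (x + 1) (Suc j))"
proof -
  have "gegenbauer_log_sum n x = (\<Sum>i<Suc n. gegenbauer_coeff n x (Suc i) / of_nat (Suc i))"
    by (simp add: gegenbauer_log_sum_def gegenbauer_coeff_eq_0)
  then have "of_nat (Suc n) * (gegenbauer_log_sum (Suc n) x - gegenbauer_log_sum n x)
      = (\<Sum>i<Suc n. of_nat (Suc n)
          * ((gegenbauer_coeff (Suc n) x (Suc i) - gegenbauer_coeff n x (Suc i)) / of_nat (Suc i)))"
    by (simp only: gegenbauer_log_sum_def[of "Suc n"] sum_distrib_left diff_divide_distrib
        flip: sum_subtractf)
  also have "\<dots> = 2 * (x + of_nat (Suc n)) * - (\<Sum>j<Suc n.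
      pochhammer (x + 1 - (2 * x + of_nat (Suc n) + 1) + 1) j / pochhammer (x + 1) (Suc j))"
    unfolding gegenbauer_coeff_Suc_diff sum_pochhammer_Vandermonde_tail[OF assms, symmetric]
    by (rule sum_distrib_left[symmetric])
  also have "x + 1 - (2 * x + of_nat (Suc n) + 1) + 1 = - (x + of_nat n)"
    by simp
  finally show ?thesis
    by (simp only: mult_minus_left mult_minus_right)
qed

lemma gegenbauer_log_sum_Suc_odd:
  assumes "even n" "pochhammer (x + 1) (Suc n) \<noteq> 0"
  shows "gegenbauer_log_sum (Suc n) x = gegenbauer_log_sum n x - 2 / of_nat (Suc n)"
proof -
  have "x + of_nat (Suc n) \<noteq> 0"
    using assms(2) by (simp add: pochhammer_Suc add_ac)
  moreover have "(\<Sum>j<Suc n. pochhammer (- (x + of_nat n)) j / pochhammer (x + 1) (Suc j))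
      = 1 / (x + of_nat (Suc n))"
    using sum_pochhammer_quotient_reflect[OF _ assms(2)] assms(1) by (simp add: add_ac)
  ultimately have "of_nat (Suc n) * (gegenbauer_log_sum (Suc n) x - gegenbauer_log_sum n x) = - 2"
    unfolding gegenbauer_log_sum_Suc[OF assms(2)]
    by (simp del: of_nat_Suc distrib_left_numeral)
  then show ?thesis
    by (simp add: field_simps del: of_nat_Suc)
qed

lemma gegenbauer_log_sum_Suc_even:
  assumes "odd n" "pochhammer (x + 1) (Suc n) \<noteq> 0"
  shows "gegenbauer_log_sum (Suc n) x = gegenbauer_log_sum n x - 2 / (2 * x + of_nat (Suc n))"
proof -
  let ?S = "\<Sum>j<Suc n. pochhammer (- (x + of_nat n)) j / pochhammer (x + 1) (Suc j)"
  obtain m where n: "n = 2 * m + 1"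
    using assms(1) by (rule oddE)
  have last: "x + of_nat (Suc n) \<noteq> 0" "pochhammer (x + 1) n \<noteq> 0"
    using assms(2) by (simp_all add: pochhammer_Suc add_ac)
  have "x + 1 + of_nat m \<noteq> 0"
    using pochhammer_neq_0_mono[OF assms(2), of "Suc m"] by (simp add: pochhammer_Suc n)
  moreover have "2 * x + of_nat (Suc n) = 2 * (x + 1 + of_nat m)"
    by (simp add: n algebra_simps)
  ultimately have middle: "2 * x + of_nat (Suc n) \<noteq> 0"
    by (simp only: mult_eq_0_iff) simp
  have "(2 * x + of_nat (Suc n)) * ?S
      = 1 - pochhammer (- (x + of_nat n)) (Suc n) / pochhammer (x + 1) (Suc n)"
    using sum_pochhammer_quotient_telescope[OF assms(2), of "- (x + of_nat n)"]
    by (simp add: algebra_simps)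
  also have "pochhammer (- (x + of_nat n)) (Suc n) = x * pochhammer (x + 1) n"
    unfolding pochhammer_minus using assms(1) by (simp add: pochhammer_rec)
  also have "x * pochhammer (x + 1) n / pochhammer (x + 1) (Suc n) = x / (x + of_nat (Suc n))"
    using last by (simp add: pochhammer_Suc add_ac)
  also have "1 - x / (x + of_nat (Suc n)) = of_nat (Suc n) / (x + of_nat (Suc n))"
    using last by (simp add: field_simps del: of_nat_Suc)
  finally have "?S = of_nat (Suc n) / (x + of_nat (Suc n)) / (2 * x + of_nat (Suc n))"
    by (simp only: nonzero_eq_divide_eq[OF middle] mult.commute[of ?S])
  then have "of_nat (Suc n) * (gegenbauer_log_sum (Suc n) x - gegenbauer_log_sum n x)
      = of_nat (Suc n) * (- 2 / (2 * x + of_nat (Suc n)))"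
    unfolding gegenbauer_log_sum_Suc[OF assms(2)] using last
    by (simp del: of_nat_Suc distrib_left_numeral)
  then have "gegenbauer_log_sum (Suc n) x - gegenbauer_log_sum n x = - 2 / (2 * x + of_nat (Suc n))"
    by (simp only: mult_cancel_left of_nat_eq_0_iff) simp
  then show ?thesis
    by (simp add: algebra_simps)
qed

section \<open>Harmonic sums\<close>

lemma gen_harm_0 [simp]: "gen_harm 0 x = 0"
  by (simp add: gen_harm_def)

lemma gen_harm_Suc: "gen_harm (int (Suc n)) x = gen_harm (int n) x + 1 / (x + of_nat (Suc n))"
  by (simp add: gen_harm_def nat_add_distrib del: of_nat_Suc)

lemma gen_harm_of_nat: "gen_harm (int n) x = (\<Sum>i<n. 1 / (x + of_nat (Suc i)))"
  by (induction n) (simp_all add: gen_harm_Suc del: of_nat_Suc)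

lemma harm_num_alternating:
  "harm_num k = (\<Sum>i<k. (-1) ^ i * of_nat (k choose Suc i) / of_nat (Suc i))"
proof -
  have quotient: "pochhammer 1 i / pochhammer 1 (Suc i) = (1 / of_nat (Suc i) :: complex)" for i
    by (simp flip: pochhammer_fact)
  have "pochhammer (- of_nat k) (Suc i) * pochhammer 1 i / (fact (Suc i) * pochhammer 1 (Suc i))
      = - ((-1) ^ i * of_nat (k choose Suc i) / of_nat (Suc i) :: complex)" for i
    unfolding times_divide_times_eq[symmetric] pochhammer_minus_of_nat_div_fact quotient
    by (simp del: of_nat_Suc)
  moreover have "pochhammer 1 k \<noteq> (0 :: complex)"
    by (simp flip: pochhammer_fact)
  ultimately show ?thesis
    using sum_pochhammer_Vandermonde_tail[of "1 :: complex" k 1]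
    by (simp add: gen_harm_of_nat quotient sum_negf del: of_nat_Suc fact_Suc)
qed

lemma sum_gegenbauer_coeff_harm_num:
  assumes "pochhammer (x + 1) n \<noteq> 0"
  shows "(\<Sum>k\<le>n. gegenbauer_coeff n x k * harm_num k) = (-1) ^ Suc n * gegenbauer_log_sum n x"
proof -
  have harm: "harm_num k = (\<Sum>i<n. (-1) ^ i * of_nat (k choose Suc i) / of_nat (Suc i))"
    if "k \<le> n" for k
    unfolding harm_num_alternating by (rule sum.mono_neutral_left) (use that in auto)
  have "(\<Sum>k\<le>n. gegenbauer_coeff n x k * harm_num k)
      = (\<Sum>k\<le>n. \<Sum>i<n. (-1) ^ i / of_nat (Suc i)
        * (gegenbauer_coeff n x k * of_nat (k choose Suc i)))"
    by (rule sum.cong) (simp_all add: harm sum_distrib_left mult_ac)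
  also have "\<dots> = (\<Sum>i<n. (-1) ^ i / of_nat (Suc i)
      * (\<Sum>k\<le>n. gegenbauer_coeff n x k * of_nat (k choose Suc i)))"
    by (subst sum.swap) (simp only: sum_distrib_left)
  also have "\<dots> = (\<Sum>i<n. (-1) ^ Suc n * (gegenbauer_coeff n x (Suc i) / of_nat (Suc i)))"
    unfolding sum_gegenbauer_coeff_binomial[OF assms]
    by (simp add: power_add mult_ac del: of_nat_Suc)
  finally show ?thesis
    by (simp only: gegenbauer_log_sum_def sum_distrib_left)
qed

lemma sum_gegenbauer_coeff_mult_harm_num:
  assumes "pochhammer (x + 1) (Suc n) \<noteq> 0"
  shows "(\<Sum>k\<le>Suc n. gegenbauer_coeff (Suc n) x k * of_nat k * harm_num k)
    = (-1) ^ Suc n - 1 + (-1) ^ n * (of_nat (Suc n) * (2 * x + of_nat (Suc n) + 1) / (x + 1))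
        * gegenbauer_log_sum n (x + 1)"
proof -
  let ?c = "of_nat (Suc n) * (2 * x + of_nat (Suc n) + 1) / (x + 1)"
  have shifted: "pochhammer (x + 1 + 1) n \<noteq> 0"
    using assms by (simp add: pochhammer_rec)
  have "gegenbauer_coeff (Suc n) x (Suc k) * of_nat (Suc k) * harm_num (Suc k)
      = gegenbauer_coeff (Suc n) x (Suc k) - ?c * (gegenbauer_coeff n (x + 1) k * harm_num k)" for k
  proof -
    have "of_nat (Suc k) * harm_num (Suc k) = of_nat (Suc k) * harm_num k + 1"
      by (simp add: gen_harm_Suc distrib_left del: of_nat_Suc)
    then have "gegenbauer_coeff (Suc n) x (Suc k) * of_nat (Suc k) * harm_num (Suc k)
        = of_nat (Suc k) * gegenbauer_coeff (Suc n) x (Suc k) * harm_num k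
          + gegenbauer_coeff (Suc n) x (Suc k)"
      by (simp only: mult.assoc) (simp only: algebra_simps mult_1_left mult_1_right)
    then show ?thesis
      unfolding of_nat_Suc_mult_gegenbauer_coeff by (simp only: mult_minus_left mult.assoc) simp
  qed
  then have "(\<Sum>k\<le>Suc n. gegenbauer_coeff (Suc n) x k * of_nat k * harm_num k)
      = (\<Sum>k\<le>n. gegenbauer_coeff (Suc n) x (Suc k))
        - ?c * (\<Sum>k\<le>n. gegenbauer_coeff n (x + 1) k * harm_num k)"
    by (simp only: sum.atMost_Suc_shift sum_subtractf sum_distrib_left) simp
  also have "(\<Sum>k\<le>n. gegenbauer_coeff (Suc n) x (Suc k)) = (-1) ^ Suc n - 1"
    using sum_gegenbauer_coeff_binomial[OF assms, of 0]
    by (simp add: sum.atMost_Suc_shift eq_diff_eq add.commute del: sum.atMost_Suc)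
  also note sum_gegenbauer_coeff_harm_num[OF shifted]
  finally show ?thesis
    by simp
qed

lemma gegenbauer_log_sum_eq_harm:
  assumes "pochhammer (x + 1) n \<noteq> 0"
  shows "gegenbauer_log_sum n x
    = harm_num (Suc n div 2) - 2 * harm_num (2 * (Suc n div 2)) - gen_harm (int (n div 2)) x"
  using assms
proof (induction n)
  case 0
  show ?case by (simp add: gegenbauer_log_sum_def)
next
  case (Suc n)
  have "pochhammer (x + 1) n \<noteq> 0"
    using pochhammer_neq_0_mono[OF Suc.prems, of n] by simp
  note IH = Suc.IH[OF this]
  show ?case
  proof (cases "even n")
    case True
    then obtain m where n: "n = 2 * m" ..
    have "of_nat (Suc (Suc (2 * m))) = (2 * of_nat (Suc m) :: complex)"
      by simp
    then have "harm_num (Suc m) - 2 * harm_num (2 * Suc m)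
        = harm_num m - 2 * harm_num (2 * m) - 2 / of_nat (Suc (2 * m))"
      by (simp only: mult_Suc_right add_2_eq_Suc gen_harm_Suc distrib_left add_0)
        (simp del: of_nat_Suc)
    then show ?thesis
      using gegenbauer_log_sum_Suc_odd[OF True Suc.prems] IH by (simp add: n)
  next
    case False
    then obtain m where n: "n = 2 * m + 1" ..
    have "2 * x + of_nat (Suc n) = 2 * (x + of_nat (Suc m))"
      by (simp add: n)
    then have "gegenbauer_log_sum (Suc n) x = gegenbauer_log_sum n x - 1 / (x + of_nat (Suc m))"
      using gegenbauer_log_sum_Suc_even[OF False Suc.prems]
      by (simp del: of_nat_Suc distrib_left_numeral)
    moreover have "n div 2 = m" "Suc n div 2 = Suc m" "Suc (Suc n) div 2 = Suc m"
      by (simp_all add: n)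
    ultimately show ?thesis
      using IH by (simp only: gen_harm_Suc) simp
  qed
qed

lemma sum_gegenbauer_coeff_mult_harm_num_even:
  assumes "pochhammer (x + 1) (2 * Suc m) \<noteq> 0"
  shows "(\<Sum>k\<le>2 * Suc m. gegenbauer_coeff (2 * Suc m) x k * of_nat k * harm_num k)
    = of_nat (2 * Suc m) * (2 * x + of_nat (2 * Suc m) + 1) / (x + 1)
      * (gen_harm (int m) (x + 1) + 2 * harm_num (2 * Suc m) - harm_num (Suc m))"
proof -
  define c where "c = of_nat (2 * Suc m) * (2 * x + of_nat (2 * Suc m) + 1) / (x + 1)"
  have double: "2 * Suc m = Suc (Suc (2 * m))"
    by simp
  have "pochhammer (x + 1 + 1) (Suc (2 * m)) \<noteq> 0"
    using assms unfolding double pochhammer_rec[of "x + 1"] by simp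
  from gegenbauer_log_sum_eq_harm[OF this]
  have log_sum: "gegenbauer_log_sum (Suc (2 * m)) (x + 1)
      = harm_num (Suc m) - 2 * harm_num (2 * Suc m) - gen_harm (int m) (x + 1)"
    by simp
  have "(\<Sum>k\<le>2 * Suc m. gegenbauer_coeff (2 * Suc m) x k * of_nat k * harm_num k)
      = - (c * gegenbauer_log_sum (Suc (2 * m)) (x + 1))"
    using sum_gegenbauer_coeff_mult_harm_num[OF assms[unfolded double]]
    unfolding double[symmetric] c_def[symmetric] by simp
  then show ?thesis
    unfolding log_sum c_def[symmetric] by (simp add: right_diff_distrib distrib_left)
qed

lemma sum_gegenbauer_coeff_mult_harm_num_odd:
  assumes "pochhammer (x + 1) (Suc (2 * m)) \<noteq> 0"
  shows "(\<Sum>k\<le>Suc (2 * m). gegenbauer_coeff (Suc (2 * m)) x k * of_nat k * harm_num k)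
    = of_nat (Suc (2 * m)) * (2 * x + of_nat (Suc (2 * m)) + 1) / (x + 1)
      * (harm_num m - 2 * harm_num (2 * m) - gen_harm (int m) (x + 1)
         - (x + 1) / ((2 * of_nat m + 1) * (x + of_nat m + 1)))"
proof -
  define c where "c = of_nat (Suc (2 * m)) * (2 * x + of_nat (Suc (2 * m)) + 1) / (x + 1)"
  have shifted: "x + 1 \<noteq> 0" "pochhammer (x + 1 + 1) (2 * m) \<noteq> 0"
    using assms unfolding pochhammer_rec[of "x + 1"] by simp_all
  have middle: "x + of_nat m + 1 \<noteq> 0"
    using pochhammer_neq_0_mono[OF assms, of "Suc m"] by (simp add: pochhammer_Suc add_ac)
  have "2 * of_nat m + 1 = (of_nat (Suc (2 * m)) :: complex)"
    "2 * x + of_nat (Suc (2 * m)) + 1 = 2 * (x + of_nat m + 1)"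
    by simp_all
  then have correction: "c * ((x + 1) / ((2 * of_nat m + 1) * (x + of_nat m + 1))) = 2"
    unfolding c_def using shifted(1) middle by (simp del: of_nat_Suc distrib_left_numeral)
  have "(\<Sum>k\<le>Suc (2 * m). gegenbauer_coeff (Suc (2 * m)) x k * of_nat k * harm_num k)
      = c * (harm_num m - 2 * harm_num (2 * m) - gen_harm (int m) (x + 1)) - 2"
    using sum_gegenbauer_coeff_mult_harm_num[OF assms] gegenbauer_log_sum_eq_harm[OF shifted(2)]
    unfolding c_def[symmetric] by simp
  then show ?thesis
    unfolding c_def[symmetric] by (simp only: right_diff_distrib correction)
qed

theorem theorem2:
  fixes x :: complex and n :: nat
  assumes "\<And>k. k \<le> n \<Longrightarrow> (x + of_nat k) gchoose k \<noteq> 0"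
    and "x + 1 \<noteq> 0"
  shows "(\<Sum>k = 0..n. (-1) ^ k * of_nat (n choose k)
            * (((2 * x + of_nat n + of_nat k) gchoose k) / ((x + of_nat k) gchoose k))
            * of_nat k * harm_num k)
       = of_nat n * (2 * x + of_nat n + 1) / (x + 1)
         * (let m = n div 2 in
            if even n
            then gen_harm (int m - 1) (x + 1) + 2 * harm_num (2 * m) - harm_num m
            else harm_num m - 2 * harm_num (2 * m) - gen_harm (int m) (x + 1)
                 - (x + 1) / ((2 * of_nat m + 1) * (x + of_nat m + 1)))"
proof -
  have nonzero: "pochhammer (x + 1) n \<noteq> 0"
    using assms(1)[of n] by (simp add: gchoose_add_eq_pochhammer)
  show ?thesis
  proof (cases "even n")
    case True
    then obtain l where l: "n = 2 * l" ..
    show ?thesis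
    proof (cases l)
      case 0
      then show ?thesis by (simp add: l)
    next
      case (Suc m)
      then have even: "n = 2 * Suc m"
        by (simp only: l)
      then have "n div 2 = Suc m" "int (Suc m) - 1 = int m"
        by simp_all
      with True show ?thesis
        unfolding gegenbauer_coeff_eq_gchoose[symmetric] atMost_atLeast0[symmetric] Let_def
        using sum_gegenbauer_coeff_mult_harm_num_even[OF nonzero[unfolded even]] even
        by (simp only: if_True)
    qed
  next
    case False
    then obtain m where "n = 2 * m + 1" ..
    then have odd: "n = Suc (2 * m)" "n div 2 = m"
      by simp_all
    with False show ?thesis
      unfolding gegenbauer_coeff_eq_gchoose[symmetric] atMost_atLeast0[symmetric] Let_def
      using sum_gegenbauer_coeff_mult_harm_num_odd[OF nonzero[unfolded odd(1)]] odd
      by (simp only: if_False)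
  qed
qed

end
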